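(* Let $c \geq 1$ and let $G$ be a $c$-cyclic graph on $n$ vertices, i.e., a connected finite simple graph with $n-1+c$ edges. Then $1 \leq \frac{m_G[2,n]}{\gamma(G)} \leq c+1$.
   Context: For a finite simple undirected graph $G$ on $n$ vertices, its Laplacian matrix is $L_G = D - A$, where $A$ is the adjacency matrix and $D$ is the diagonal matrix of vertex degrees; its eigenvalues lie in $[0,n]$. For a real interval $I$, $m_G(I)$ denotes the number of Laplacian eigenvalues of $G$, counted with multiplicity, lying in $I$. A set $S$ of vertices is dominating if every vertex not in $S$ is adjacent to some vertex of $S$; the domination number $\gamma(G)$ is the minimum size of a dominating set. *)

theory Defs
  imports
    "Graph_Theory.Digraph_Component"
    "Jordan_Normal_Form.Char_Poly"
begin

text \<open>
  A finite simple undirected graph is a \<^locale>\<open>pair_graph\<close>: a finite vertex set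
  \<^term>\<open>pverts G\<close> with a symmetric, loop-free arc set \<^term>\<open>parcs G\<close> of ordered pairs
  of vertices. An undirected edge is represented by two opposite arcs, hence the passage to
  unordered pairs when edges are counted.
\<close>

definition edges :: "'a pair_pre_digraph \<Rightarrow> 'a set set" where
  "edges G = {{u, v} |u v. (u, v) \<in> parcs G}"

text \<open>Connectedness includes \<^prop>\<open>pverts G \<noteq> {}\<close>, so the subtraction does not truncate.\<close>

definition c_cyclic :: "nat \<Rightarrow> 'a pair_pre_digraph \<Rightarrow> bool" where
  "c_cyclic c G \<longleftrightarrow>
     pair_graph G \<and> Digraph_Component.connected (with_proj G) \<and>
     card (edges G) = card (pverts G) - 1 + c"

definition dominating_set :: "'a pair_pre_digraph \<Rightarrow> 'a set \<Rightarrow> bool" where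
  "dominating_set G S \<longleftrightarrow>
     S \<subseteq> pverts G \<and> (\<forall>v \<in> pverts G - S. \<exists>u \<in> S. (v, u) \<in> parcs G)"

definition domination_number :: "'a pair_pre_digraph \<Rightarrow> nat" where
  "domination_number G = Min (card ` {S. dominating_set G S})"

text \<open>
  Matrices are indexed by natural numbers, so the adjacency and degree matrices are formed with
  respect to a list \<open>vs\<close> that enumerates the vertices without repetition.
\<close>

definition adjacency_matrix :: "'a pair_pre_digraph \<Rightarrow> 'a list \<Rightarrow> real mat" where
  "adjacency_matrix G vs = Matrix.mat (length vs) (length vs)
     (\<lambda>(i, j). if (vs ! i, vs ! j) \<in> parcs G then 1 else 0)"

definition degree_matrix :: "'a pair_pre_digraph \<Rightarrow> 'a list \<Rightarrow> real mat" where
  "degree_matrix G vs = Matrix.mat (length vs) (length vs)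
     (\<lambda>(i, j). if i = j then real (out_degree (with_proj G) (vs ! i)) else 0)"

definition laplacian_matrix :: "'a pair_pre_digraph \<Rightarrow> 'a list \<Rightarrow> real mat" where
  "laplacian_matrix G vs = degree_matrix G vs - adjacency_matrix G vs"

definition vertex_enumeration :: "'a pair_pre_digraph \<Rightarrow> 'a list" where
  "vertex_enumeration G = (SOME vs. distinct vs \<and> set vs = pverts G)"

definition laplacian :: "'a pair_pre_digraph \<Rightarrow> real mat" where
  "laplacian G = laplacian_matrix G (vertex_enumeration G)"

text \<open>
  The multiplicity of an eigenvalue is its multiplicity as a root of the characteristic
  polynomial.
\<close>

definition laplacian_eigenvalue_count :: "'a pair_pre_digraph \<Rightarrow> real set \<Rightarrow> nat" where
  "laplacian_eigenvalue_count G I =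
     (\<Sum>x | eigenvalue (laplacian G) x \<and> x \<in> I. Polynomial.order x (char_poly (laplacian G)))"

text \<open>The spectrum does not depend on the chosen enumeration of the vertices.\<close>

lemma vertex_enumeration:
  assumes "finite (pverts G)"
  shows "distinct (vertex_enumeration G)" "set (vertex_enumeration G) = pverts G"
proof -
  have "\<exists>vs. distinct vs \<and> set vs = pverts G"
    using finite_distinct_list[OF assms] by blast
  then have "distinct (vertex_enumeration G) \<and> set (vertex_enumeration G) = pverts G"
    unfolding vertex_enumeration_def by (rule someI_ex)
  then show "distinct (vertex_enumeration G)" "set (vertex_enumeration G) = pverts G"
    by auto
qed

lemma laplacian_matrix_reorder:
  assumes "distinct vs" "distinct ws" "set vs = set ws"
  shows "similar_mat (laplacian_matrix G vs) (laplacian_matrix G ws)"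
proof -
  define n where "n = length vs"
  have n': "length ws = n"
    using assms unfolding n_def by (metis distinct_card)
  define e where "e i j = (if vs ! i = ws ! j then 1 else (0::real))" for i j
  define l where "l u v = (if u = v then real (out_degree (with_proj G) u) else 0) -
      (if (u, v) \<in> parcs G then 1 else (0::real))" for u v
  define P where "P = Matrix.mat n n (\<lambda>(i, j). e i j)"
  define Q where "Q = Matrix.mat n n (\<lambda>(i, j). e j i)"
  have bv: "bij_betw (\<lambda>i. vs ! i) {0..<n} (set vs)"
    using bij_betw_nth[OF assms(1)] n_def by (auto simp: atLeast0LessThan)
  have bw: "bij_betw (\<lambda>i. ws ! i) {0..<n} (set vs)"
    using bij_betw_nth[OF assms(2)] n' assms(3) by (auto simp: atLeast0LessThan)
  have sv: "(\<Sum>k = 0..<n. f (vs ! k)) = (\<Sum>v\<in>set vs. f v)" for f :: "'a \<Rightarrow> real"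
    using sum.reindex_bij_betw[OF bv] .
  have sw: "(\<Sum>k = 0..<n. f (ws ! k)) = (\<Sum>v\<in>set vs. f v)" for f :: "'a \<Rightarrow> real"
    using sum.reindex_bij_betw[OF bw] .
  have iv: "vs ! i \<in> set vs" "ws ! i \<in> set vs" if "i < n" for i
    using that nth_mem[of i vs] nth_mem[of i ws] n' assms(3) by (simp_all add: n_def)
  have L: "laplacian_matrix G us = Matrix.mat n n (\<lambda>(i, j). l (us ! i) (us ! j))"
    if "distinct us" "length us = n" for us
    using that
    by (intro eq_matI) (simp_all add: laplacian_matrix_def degree_matrix_def adjacency_matrix_def
        l_def nth_eq_iff_index_eq)
  note Lv = L[OF assms(1) n_def[symmetric]] and Lw = L[OF assms(2) n']
  have c: "P \<in> carrier_mat n n" "Q \<in> carrier_mat n n"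
    by (auto simp: P_def Q_def)
  have PQ: "P * Q = 1\<^sub>m n"
  proof (rule eq_matI)
    fix i j assume "i < dim_row (1\<^sub>m n :: real mat)" "j < dim_col (1\<^sub>m n :: real mat)"
    then have ij: "i < n" "j < n" by auto
    have "(P * Q) $$ (i, j) = (\<Sum>k = 0..<n. e i k * e j k)"
      using ij by (simp add: P_def Q_def scalar_prod_def)
    also have "\<dots> = (\<Sum>v\<in>set vs. (if vs ! i = v then 1 else 0) * (if vs ! j = v then 1 else 0))"
      unfolding e_def by (rule sw)
    also have "\<dots> = (if vs ! i = vs ! j then 1 else 0)"
      using iv(1)[OF ij(1)] iv(1)[OF ij(2)]
      by (simp add: if_distrib[of "\<lambda>x. x * _"] cong: if_cong)
    finally show "(P * Q) $$ (i, j) = 1\<^sub>m n $$ (i, j)"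
      using ij assms(1) n_def by (auto simp: nth_eq_iff_index_eq)
  qed (auto simp: P_def Q_def)
  have QP: "Q * P = 1\<^sub>m n"
    using mat_mult_left_right_inverse[OF c PQ] .
  have LP: "laplacian_matrix G vs * P = P * laplacian_matrix G ws"
  proof (rule eq_matI)
    fix i j assume "i < dim_row (P * laplacian_matrix G ws)" "j < dim_col (P * laplacian_matrix G ws)"
    then have ij: "i < n" "j < n" by (auto simp: P_def Lw)
    have "(laplacian_matrix G vs * P) $$ (i, j) = (\<Sum>k = 0..<n. l (vs ! i) (vs ! k) * e k j)"
      using ij by (simp add: P_def Lv scalar_prod_def)
    also have "\<dots> = (\<Sum>v\<in>set vs. l (vs ! i) v * (if v = ws ! j then 1 else 0))"
      unfolding e_def by (rule sv)
    also have "\<dots> = l (vs ! i) (ws ! j)"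
      using iv(2)[OF ij(2)] by (simp add: if_distrib cong: if_cong)
    also have "\<dots> = (\<Sum>v\<in>set vs. (if vs ! i = v then 1 else 0) * l v (ws ! j))"
      using iv(1)[OF ij(1)] by (simp add: if_distrib[of "\<lambda>x. x * _"] cong: if_cong)
    also have "\<dots> = (\<Sum>k = 0..<n. e i k * l (ws ! k) (ws ! j))"
      unfolding e_def by (rule sw[symmetric])
    also have "\<dots> = (P * laplacian_matrix G ws) $$ (i, j)"
      using ij by (simp add: P_def Lw scalar_prod_def)
    finally show "(laplacian_matrix G vs * P) $$ (i, j) = (P * laplacian_matrix G ws) $$ (i, j)" .
  qed (auto simp: P_def Lv Lw)
  have cL: "laplacian_matrix G vs \<in> carrier_mat n n" "laplacian_matrix G ws \<in> carrier_mat n n"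
    by (auto simp: Lv Lw)
  have "laplacian_matrix G vs = laplacian_matrix G vs * (P * Q)"
    using cL by (simp add: PQ)
  also have "\<dots> = laplacian_matrix G vs * P * Q"
    by (rule assoc_mult_mat[OF cL(1) c, symmetric])
  also have "\<dots> = P * laplacian_matrix G ws * Q"
    unfolding LP ..
  finally have "similar_mat_wit (laplacian_matrix G vs) (laplacian_matrix G ws) P Q"
    using c cL PQ QP by (auto simp: similar_mat_wit_def Let_def)
  then show ?thesis
    unfolding similar_mat_def by blast
qed

lemma char_poly_laplacian:
  assumes "finite (pverts G)" "distinct vs" "set vs = pverts G"
  shows "char_poly (laplacian_matrix G vs) = char_poly (laplacian G)"
  unfolding laplacian_def
  using char_poly_similar laplacian_matrix_reorder vertex_enumeration[OF assms(1)] assms(2,3)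
  by metis

end

theory Submission
  imports Defs "Jordan_Normal_Form.Schur_Decomposition"
begin

text \<open>
  Both bounds compare the quadratic form of the Laplacian, which is the sum of
  \<open>(x u - x w)\<^sup>2\<close> over the edges, with \<open>2 |x|\<^sup>2\<close>, in the manner of Courant and Fischer.

  Lower bound: a connected graph with at least two vertices has a matching with at least \<open>\<gamma>\<close> edges.
  On the span of the vectors \<open>e\<^sub>u - e\<^sub>v\<close>, for \<open>uv\<close> in the matching, the form is at least
  \<open>2 |x|\<^sup>2\<close>.

  Upper bound: let \<open>S\<close> be a minimum dominating set and choose for every vertex outside \<open>S\<close> one edge to
  \<open>S\<close>. There remain \<open>\<gamma> - 1 + c\<close> edges. If \<open>x\<close> vanishes on \<open>S\<close> and takes equal values at the ends of
  each remaining edge, then the form is \<open>|x|\<^sup>2\<close>. These are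
  \<open>2 \<gamma> - 1 + c \<le> (c + 1) \<gamma>\<close> linear conditions on \<open>x\<close>.
\<close>

section \<open>Diagonalisation of real symmetric matrices\<close>

lemma real_scalar_prod_self:
  fixes v :: "real Matrix.vec"
  assumes "v \<in> carrier_vec n" "v \<noteq> 0\<^sub>v n"
  shows "v \<bullet> v > 0"
proof -
  have "v \<bullet> v \<noteq> 0"
    using conjugate_square_eq_0_vec[OF assms(1)] assms(2) by auto
  moreover have "v \<bullet> v \<ge> 0"
    by (auto simp: scalar_prod_def intro!: sum_nonneg)
  ultimately show ?thesis by simp
qed

text \<open>Over the complex numbers the characteristic polynomial splits, so there is an eigenvalue
  \<open>z\<close> with an eigenvector \<open>w\<close>. Because \<open>A\<close> is real and
  symmetric, the Hermitian form \<open>T\<close> at \<open>w\<close> equals its own conjugate; it is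
  also \<open>z\<close> times the positive number \<open>S\<close>, so \<open>z\<close> is
  real.\<close>

lemma real_symmetric_eigenvector:
  fixes A :: "real mat"
  assumes A: "A \<in> carrier_mat n n" and sym: "transpose_mat A = A" and n: "n > 0"
  shows "\<exists>v e. v \<in> carrier_vec n \<and> v \<bullet> v = 1 \<and> A *\<^sub>v v = e \<cdot>\<^sub>v v"
proof -
  define B where "B = map_mat complex_of_real A"
  have B: "B \<in> carrier_mat n n" using A by (simp add: B_def)
  obtain as where as: "char_poly B = (\<Prod>a\<leftarrow>as. [:- a, 1:])" "length as = n"
    using char_poly_factorized[OF B] by blast
  then obtain z zs where "as = z # zs" using n by (cases as) auto
  then have "poly (char_poly B) z = 0" by (simp add: as(1))
  then have "eigenvalue B z" using eigenvalue_root_char_poly[OF B] by simp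
  then obtain w where w: "w \<in> carrier_vec n" "w \<noteq> 0\<^sub>v n" "B *\<^sub>v w = z \<cdot>\<^sub>v w"
    using B by (auto simp: eigenvalue_def eigenvector_def)
  define S where "S = (\<Sum>i<n. (cmod (w $ i))\<^sup>2)"
  define T where "T = (\<Sum>i<n. \<Sum>j<n. of_real (A $$ (i, j)) * w $ j * cnj (w $ i))"
  have "\<exists>i<n. w $ i \<noteq> 0"
    using w(1,2) by (metis carrier_vecD eq_vecI index_zero_vec)
  then have S: "S > 0"
    unfolding S_def by (auto intro: sum_pos2)
  have symij: "A $$ (i, j) = A $$ (j, i)" if "i < n" "j < n" for i j
    using that A sym by (metis carrier_matD index_transpose_mat(1))
  have "cnj T = (\<Sum>i<n. \<Sum>j<n. of_real (A $$ (i, j)) * cnj (w $ j) * w $ i)"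
    by (simp add: T_def)
  also have "\<dots> = (\<Sum>j<n. \<Sum>i<n. of_real (A $$ (i, j)) * cnj (w $ j) * w $ i)"
    by (rule sum.swap)
  also have "\<dots> = T"
    unfolding T_def by (intro sum.cong refl) (auto simp: symij)
  finally have T: "cnj T = T" .
  have ev: "(\<Sum>j<n. of_real (A $$ (i, j)) * w $ j) = z * w $ i" if "i < n" for i
  proof -
    have "(B *\<^sub>v w) $ i = z * w $ i" using w(1,3) that by simp
    then show ?thesis
      using that A w(1) by (simp add: B_def scalar_prod_def lessThan_atLeast0)
  qed
  have "T = (\<Sum>i<n. z * w $ i * cnj (w $ i))"
    unfolding T_def by (intro sum.cong refl) (simp add: ev flip: sum_distrib_right)
  also have "\<dots> = z * of_real S"
    by (simp add: S_def sum_distrib_left mult.assoc complex_norm_square del: of_real_power)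
  finally have "cnj z * of_real S = z * of_real S" using T by (metis complex_cnj_complex_of_real complex_cnj_mult)
  then have "cnj z = z" using S by simp
  then obtain e where e: "z = of_real e" by (metis Reals_cases Reals_cnj_iff)
  \<comment> \<open>Once \<open>z\<close> is known to be real it is a root of the real
    characteristic polynomial, and a real eigenvector is obtained from there instead of from
    \<open>w\<close>.\<close>
  have "of_real (poly (char_poly A) e) = (0::complex)"
    using \<open>poly (char_poly B) z = 0\<close> unfolding B_def of_real_hom.char_poly_hom[OF A] e
    by simp
  then have "poly (char_poly A) e = 0" by simp
  then have "eigenvalue A e" using eigenvalue_root_char_poly[OF A] by simp
  then obtain u where u: "u \<in> carrier_vec n" "u \<noteq> 0\<^sub>v n" "A *\<^sub>v u = e \<cdot>\<^sub>v u"
    using A by (auto simp: eigenvalue_def eigenvector_def)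
  define v where "v = (1 / sqrt (u \<bullet> u)) \<cdot>\<^sub>v u"
  have pos: "u \<bullet> u > 0" using real_scalar_prod_self u by blast
  have "v \<in> carrier_vec n" using u by (simp add: v_def)
  moreover have "v \<bullet> v = 1"
    using u(1) pos by (simp add: v_def)
  moreover have "A *\<^sub>v v = e \<cdot>\<^sub>v v"
    using u A by (simp add: v_def mult_mat_vec smult_smult_assoc mult.commute)
  ultimately show ?thesis by blast
qed

text \<open>Gram-Schmidt on a basis that starts with \<open>v\<close> keeps its first vector, and
  since \<open>v\<close> is a unit vector the final normalisation keeps it too.\<close>

lemma orthogonal_matrix_extending:
  fixes v :: "real Matrix.vec"
  assumes v: "v \<in> carrier_vec n" and v1: "v \<bullet> v = 1"
  shows "\<exists>W \<in> carrier_mat n n. transpose_mat W * W = 1\<^sub>m n \<and> col W 0 = v"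
proof -
  interpret cof_vec_space n "TYPE(real)" .
  have v0: "v \<noteq> 0\<^sub>v n" using v1 v by auto
  then have n: "n > 0" using v by (cases n) auto
  define ws where "ws = gram_schmidt n (basis_completion v)"
  note b = basis_completion[OF v v0]
  from gram_schmidt_result[OF b(2,4,5) refl, folded ws_def]
  have ws: "set ws \<subseteq> carrier_vec n" "corthogonal ws" "length ws = n"
    using b(6) by auto
  obtain bs where bs: "basis_completion v = v # bs"
    using b(6,7) n by (cases "basis_completion v") auto
  have hd: "ws ! 0 = v"
    using gram_schmidt_hd[OF v, of bs] ws(3) n unfolding ws_def bs by (metis hd_conv_nth length_0_conv not_less0)
  define us where "us = map (\<lambda>w. (1 / sqrt (w \<bullet> w)) \<cdot>\<^sub>v w) ws"
  have wsi: "ws ! i \<in> carrier_vec n" if "i < n" for i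
    using ws that by auto
  have us: "us ! i = (1 / sqrt (ws ! i \<bullet> ws ! i)) \<cdot>\<^sub>v ws ! i" "us ! i \<in> carrier_vec n" if "i < n" for i
    using ws that wsi by (auto simp: us_def)
  have lus: "length us = n" using ws by (simp add: us_def)
  have orth: "us ! i \<bullet> us ! j = (if i = j then 1 else 0)" if "i < n" "j < n" for i j
  proof -
    have o: "(ws ! i \<bullet> ws ! j = 0) = (i \<noteq> j)"
      using corthogonalD[OF ws(2)] that ws(3) by auto
    have "ws ! i \<bullet> ws ! i \<ge> 0"
      by (auto simp: scalar_prod_def intro!: sum_nonneg)
    then show ?thesis
      using o by (auto simp: us that wsi smult_scalar_prod_distrib[of _ n] scalar_prod_smult_distrib[of _ n])
  qed
  define W where "W = mat_of_cols n us"
  have W: "W \<in> carrier_mat n n" using mat_of_cols_carrier(1)[of n us] lus by (simp add: W_def)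
  have col: "col W i = us ! i" if "i < n" for i
    unfolding W_def using that lus us by (intro col_mat_of_cols) auto
  have "transpose_mat W * W = 1\<^sub>m n"
    using W by (intro eq_matI) (auto simp: col orth)
  moreover have "col W 0 = v"
    using n v by (simp add: col us hd v1)
  ultimately show ?thesis using W by blast
qed

text \<open>Deflation: in an orthonormal basis that starts with a unit eigenvector, symmetry clears
  the first row and the first column off the diagonal. The induction hypothesis diagonalises the
  remaining block \<open>D\<close>.\<close>

theorem real_spectral_theorem:
  fixes A :: "real mat"
  assumes "A \<in> carrier_mat n n" and "transpose_mat A = A"
  shows "\<exists>P \<in> carrier_mat n n. transpose_mat P * P = 1\<^sub>m n \<and> diagonal_mat (transpose_mat P * A * P)"
  using assms
proof (induction n arbitrary: A)
  case 0
  then show ?case by (intro bexI[of _ "1\<^sub>m 0"]) (auto simp: diagonal_mat_def)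
next
  case (Suc n)
  note A = Suc.prems(1)
  obtain v e where v: "v \<in> carrier_vec (Suc n)" "v \<bullet> v = 1" "A *\<^sub>v v = e \<cdot>\<^sub>v v"
    using real_symmetric_eigenvector[OF Suc.prems] by auto
  obtain W where W: "W \<in> carrier_mat (Suc n) (Suc n)" "transpose_mat W * W = 1\<^sub>m (Suc n)" "col W 0 = v"
    using orthogonal_matrix_extending[OF v(1,2)] by auto
  define C where "C = transpose_mat W * A * W"
  have C: "C \<in> carrier_mat (Suc n) (Suc n)" using W A by (simp add: C_def)
  have symC: "transpose_mat C = C"
    unfolding C_def using W(1) A Suc.prems(2)
    by (simp add: transpose_mult[of "_ * _" "Suc n" "Suc n" _ "Suc n"] transpose_mult[of _ "Suc n" "Suc n" _ "Suc n"]
        assoc_mult_mat[of _ "Suc n" "Suc n" _ "Suc n" _ "Suc n"])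
  \<comment> \<open>Column 0 of \<open>C\<close> is \<open>transpose_mat W\<close> applied to
    \<open>A *\<^sub>v v\<close>, hence \<open>e\<close> times column 0 of the identity
    \<open>transpose_mat W * W\<close>.\<close>
  have Ci0: "C $$ (i, 0) = (if i = 0 then e else 0)" if "i < Suc n" for i
  proof -
    have "C $$ (i, 0) = (transpose_mat W * (A * W)) $$ (i, 0)"
      using W A by (simp add: C_def assoc_mult_mat[of _ "Suc n" "Suc n"])
    also have "\<dots> = col W i \<bullet> col (A * W) 0"
      using W A that by simp
    also have "col (A * W) 0 = A *\<^sub>v col W 0"
      using W A by (intro col_mult2) auto
    also have "\<dots> = e \<cdot>\<^sub>v col W 0" using W v by simp
    also have "col W i \<bullet> (e \<cdot>\<^sub>v col W 0) = e * (col W i \<bullet> col W 0)"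
      using W(1,3) that v(1) by (intro scalar_prod_smult_distrib[of _ "Suc n"]) auto
    also have "col W i \<bullet> col W 0 = (transpose_mat W * W) $$ (i, 0)"
      using W(1) that by simp
    finally show ?thesis using W(2) that by simp
  qed
  have C0i: "C $$ (0, i) = (if i = 0 then e else 0)" if "i < Suc n" for i
    using Ci0[OF that] symC C that by (metis carrier_matD index_transpose_mat(1) zero_less_Suc)
  define D where "D = Matrix.mat n n (\<lambda>(i, j). C $$ (Suc i, Suc j))"
  define E where "E = Matrix.mat 1 1 (\<lambda>_. e)"
  have E: "E \<in> carrier_mat 1 1" by (simp add: E_def)
  have D: "D \<in> carrier_mat n n" by (simp add: D_def)
  have CD: "C = four_block_mat E (0\<^sub>m 1 n) (0\<^sub>m n 1) D"
    using C by (intro eq_matI) (auto simp: Ci0 C0i D_def E_def)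
  have "transpose_mat D = D"
  proof (rule eq_matI)
    fix i j assume "i < dim_row D" "j < dim_col D"
    then have ij: "i < n" "j < n" by (auto simp: D_def)
    have "transpose_mat C $$ (Suc i, Suc j) = C $$ (Suc j, Suc i)" using C ij by simp
    then show "transpose_mat D $$ (i, j) = D $$ (i, j)" using ij by (simp add: D_def symC)
  qed (auto simp: D_def)
  then obtain P where P: "P \<in> carrier_mat n n" "transpose_mat P * P = 1\<^sub>m n"
      "diagonal_mat (transpose_mat P * D * P)"
    using Suc.IH[OF D] by blast
  \<comment> \<open>\<open>R\<close> fixes the first coordinate and acts as \<open>P\<close> on the
    others, so that \<open>W * R\<close> diagonalises \<open>A\<close>.\<close>
  define R where "R = four_block_mat (1\<^sub>m 1) (0\<^sub>m 1 n) (0\<^sub>m n 1) P"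
  have R: "R \<in> carrier_mat (Suc n) (Suc n)"
    using four_block_carrier_mat[OF one_carrier_mat[of 1] P(1)] by (simp add: R_def)
  have Rt: "transpose_mat R = four_block_mat (1\<^sub>m 1) (0\<^sub>m 1 n) (0\<^sub>m n 1) (transpose_mat P)"
    unfolding R_def using P by (subst transpose_four_block_mat) auto
  have "transpose_mat R * R = four_block_mat (1\<^sub>m 1) (0\<^sub>m 1 n) (0\<^sub>m n 1) (1\<^sub>m n)"
    unfolding Rt unfolding R_def using P
    by (subst mult_four_block_mat[of _ 1 1 _ n _ n _ _ 1 _ n]) auto
  then have RtR: "transpose_mat R * R = 1\<^sub>m (Suc n)"
    by (metis four_block_one_mat plus_1_eq_Suc)
  have RtC: "transpose_mat R * C = four_block_mat E (0\<^sub>m 1 n) (0\<^sub>m n 1) (transpose_mat P * D)"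
    unfolding Rt CD using P D E by (subst mult_four_block_mat[of _ 1 1 _ n _ n _ _ 1 _ n]) auto
  have RtCR: "transpose_mat R * C * R = four_block_mat E (0\<^sub>m 1 n) (0\<^sub>m n 1) (transpose_mat P * D * P)"
    unfolding RtC unfolding R_def using P D E
    by (subst mult_four_block_mat[of _ 1 1 _ n _ n _ _ 1 _ n]) auto
  have diag: "diagonal_mat (transpose_mat R * C * R)"
    using P D E unfolding RtCR diagonal_mat_def by auto
  have Wt: "transpose_mat W \<in> carrier_mat (Suc n) (Suc n)" "transpose_mat R \<in> carrier_mat (Suc n) (Suc n)"
    using W R by auto
  note assoc = assoc_mult_mat[of _ "Suc n" "Suc n" _ "Suc n" _ "Suc n"]
  have tWR: "transpose_mat (W * R) = transpose_mat R * transpose_mat W"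
    using W R by (rule_tac transpose_mult) auto
  have "transpose_mat (W * R) * A * (W * R) = transpose_mat R * C * R"
    unfolding tWR C_def using W(1) R A Wt by (simp add: assoc)
  moreover have "transpose_mat (W * R) * (W * R) = transpose_mat R * (transpose_mat W * W) * R"
    unfolding tWR using W(1) R Wt by (simp add: assoc)
  ultimately show ?case
    using diag RtR W R by (intro bexI[of _ "W * R"]) auto
qed

section \<open>Homogeneous linear systems\<close>

text \<open>Gaussian elimination, by induction on the equations. An equation with zero coefficients
  is dropped; any other one eliminates an unknown \<open>i\<close> from the rest, so that both
  counts fall by one.\<close>

lemma underdetermined_system:
  fixes f :: "'k \<Rightarrow> 'j \<Rightarrow> real"
  assumes "finite K" "finite J" "card K < card J"
  shows "\<exists>c. (\<exists>j\<in>J. c j \<noteq> 0) \<and> (\<forall>k\<in>K. (\<Sum>j\<in>J. c j * f k j) = 0)"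
  using assms
proof (induction K arbitrary: J f rule: finite_induct)
  case empty
  then have "J \<noteq> {}" by auto
  then show ?case by (intro exI[of _ "\<lambda>_. 1"]) auto
next
  case (insert k K)
  show ?case
  proof (cases "\<forall>j\<in>J. f k j = 0")
    case True
    have "card K < card J" using insert by simp
    then show ?thesis using insert.IH[OF insert.prems(1), of f] True by auto
  next
    case False
    then obtain i where i: "i \<in> J" "f k i \<noteq> 0" by blast
    define J' where "J' = J - {i}"
    have "card K < card J'" "finite J'"
      using insert i by (auto simp: J'_def)
    then obtain c where c: "\<exists>j\<in>J'. c j \<noteq> 0"
        "\<forall>k'\<in>K. (\<Sum>j\<in>J'. c j * (f k' j - f k' i * f k j / f k i)) = 0"
      using insert.IH[of J' "\<lambda>k' j. f k' j - f k' i * f k j / f k i"] by blast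
    \<comment> \<open>The value that equation \<open>k\<close> forces on the eliminated
      unknown.\<close>
    define t where "t = - (\<Sum>j\<in>J'. c j * f k j) / f k i"
    define d where "d = c(i := t)"
    have sum: "(\<Sum>j\<in>J. d j * g j) = t * g i + (\<Sum>j\<in>J'. c j * g j)" for g
    proof -
      have "(\<Sum>j\<in>J. d j * g j) = d i * g i + (\<Sum>j\<in>J'. d j * g j)"
        unfolding J'_def using insert.prems(1) i(1) by (rule sum.remove)
      also have "(\<Sum>j\<in>J'. d j * g j) = (\<Sum>j\<in>J'. c j * g j)"
        by (intro sum.cong) (auto simp: d_def J'_def)
      finally show ?thesis by (simp add: d_def)
    qed
    have "(\<Sum>j\<in>J. d j * f k' j) = 0" if "k' \<in> insert k K" for k'
    proof (cases "k' = k")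
      case True
      then show ?thesis using i by (simp add: sum t_def)
    next
      case False
      then have "0 = (\<Sum>j\<in>J'. c j * (f k' j - f k' i * f k j / f k i))"
        using c(2) that by auto
      also have "\<dots> = (\<Sum>j\<in>J'. c j * f k' j) - (\<Sum>j\<in>J'. c j * f k j) * (f k' i / f k i)"
        by (simp add: algebra_simps sum_subtractf sum_distrib_left)
      finally show ?thesis by (simp add: sum t_def)
    qed
    moreover have "\<exists>j\<in>J. d j \<noteq> 0"
      using c(1) by (auto simp: d_def J'_def)
    ultimately show ?thesis by blast
  qed
qed

section \<open>Dominating sets and matchings\<close>

lemma (in pair_graph) finite_dominating: "finite {S. dominating_set G S}"
  by (rule finite_subset[of _ "Pow (pverts G)"]) (auto simp: dominating_set_def pair_finite_verts)

lemma (in pair_graph) domination_number_le: "dominating_set G S \<Longrightarrow> domination_number G \<le> card S"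
  unfolding domination_number_def using finite_dominating by (intro Min_le) auto

lemma (in pair_graph) minimum_dominating_set:
  "\<exists>S. dominating_set G S \<and> card S = domination_number G"
proof -
  have "dominating_set G (pverts G)" by (auto simp: dominating_set_def)
  then have "domination_number G \<in> card ` {S. dominating_set G S}"
    unfolding domination_number_def using finite_dominating by (intro Min_in) auto
  then show ?thesis by auto
qed

context pair_graph
begin

lemma arc_sym: "(u, v) \<in> parcs G \<Longrightarrow> (v, u) \<in> parcs G"
  using pair_sym_arcs by (auto simp: symmetric_def elim: symE)

lemma arc_neq: "(u, v) \<in> parcs G \<Longrightarrow> u \<noteq> v"
  using pair_no_loops by fastforce

end

text \<open>Each matching edge is represented by one of its two arcs: in a loop-free graph opposite
  arcs are distinct but share their ends, so the disjointness condition excludes having both. Hence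
  \<open>card M\<close> is the number of matching edges.\<close>

definition matching :: "'a pair_pre_digraph \<Rightarrow> 'a rel \<Rightarrow> bool" where
  "matching G M \<longleftrightarrow> M \<subseteq> parcs G \<and>
     (\<forall>e\<in>M. \<forall>e'\<in>M. e \<noteq> e' \<longrightarrow> {fst e, snd e} \<inter> {fst e', snd e'} = {})"

lemma matching_insert:
  assumes "matching G M" "(u, v) \<in> parcs G" "u \<notin> Field M" "v \<notin> Field M"
  shows "matching G (insert (u, v) M)"
proof -
  have F: "fst e \<in> Field M \<and> snd e \<in> Field M" if "e \<in> M" for e
    using that by (cases e) (auto intro: FieldI1 FieldI2)
  have N: "{u, v} \<inter> {fst e, snd e} = {}" if "e \<in> M" for e
    using assms(3,4) F[OF that] by auto
  show ?thesis
    unfolding matching_def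
  proof (intro conjI ballI impI)
    show "insert (u, v) M \<subseteq> parcs G" using assms(1,2) by (simp add: matching_def)
  next
    fix e e' assume e: "e \<in> insert (u, v) M" "e' \<in> insert (u, v) M" "e \<noteq> e'"
    then consider "e = (u, v)" "e' \<in> M" | "e \<in> M" "e' = (u, v)" | "e \<in> M" "e' \<in> M"
      by blast
    then show "{fst e, snd e} \<inter> {fst e', snd e'} = {}"
    proof cases
      case 1
      then show ?thesis using N[of e'] by simp
    next
      case 2
      then show ?thesis using N[of e] by (simp add: Int_commute)
    next
      case 3
      then show ?thesis using assms(1) e(3) by (simp add: matching_def)
    qed
  qed
qed

lemma matching_subset: "matching G M \<Longrightarrow> N \<subseteq> M \<Longrightarrow> matching G N"
  unfolding matching_def by blast

text \<open>
  Since a maximum matching has no augmenting path, at most one end of each matching edge has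
  unmatched neighbours, unless both ends have the same single one. Picking that end from each
  matching edge gives a dominating set.
\<close>

lemma (in pair_graph) domination_number_le_matching:
  assumes noiso: "\<And>v. v \<in> pverts G \<Longrightarrow> \<exists>u. (v, u) \<in> parcs G"
  shows "\<exists>M. matching G M \<and> domination_number G \<le> card M"
proof -
  have bound: "card M \<le> card (parcs G)" if "matching G M" for M
    using that pair_finite_arcs by (auto simp: matching_def intro: card_mono)
  have "matching G {}" by (simp add: matching_def)
  then obtain M where M: "matching G M" and max: "\<And>M'. matching G M' \<Longrightarrow> card M' \<le> card M"
    using ex_has_greatest_nat[of "matching G" "{}" card "Suc (card (parcs G))"] bound
    by (auto simp: less_Suc_eq_le)
  have Mp: "M \<subseteq> parcs G" and disj: "\<And>e e'. e \<in> M \<Longrightarrow> e' \<in> M \<Longrightarrow> e \<noteq> e' \<Longrightarrow> {fst e, snd e} \<inter> {fst e', snd e'} = {}"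
    using M by (auto simp: matching_def)
  have fin: "finite M" using Mp pair_finite_arcs finite_subset by blast
  define U where "U = pverts G - Field M"
  have indep: "(x, y) \<notin> parcs G" if "x \<in> U" "y \<in> U" for x y
  proof
    assume xy: "(x, y) \<in> parcs G"
    have "(x, y) \<notin> M" using that FieldI1[of x y M] by (auto simp: U_def)
    moreover have "matching G (insert (x, y) M)"
      using that xy M by (intro matching_insert) (auto simp: U_def)
    ultimately show False using max[of "insert (x, y) M"] fin by simp
  qed
  \<comment> \<open>Otherwise \<open>x\<close>, \<open>u\<close>, \<open>v\<close>, \<open>y\<close>
    is an augmenting path: trading \<open>(u, v)\<close> for \<open>(u, x)\<close> and
    \<open>(v, y)\<close> enlarges the maximum matching.\<close>
  have aug: "x = y" if e: "(u, v) \<in> M" and x: "x \<in> U" "(u, x) \<in> parcs G" and y: "y \<in> U" "(v, y) \<in> parcs G" for u v x y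
  proof (rule ccontr)
    assume ne: "x \<noteq> y"
    define N where "N = M - {(u, v)}"
    have uv: "u \<noteq> v" using arc_neq e Mp by blast
    have nU: "u \<notin> U" "v \<notin> U" using FieldI1[OF e] FieldI2[OF e] by (auto simp: U_def)
    have "z \<noteq> u \<and> z \<noteq> v" if "z \<in> Field N" for z
    proof -
      from that obtain e' where e': "e' \<in> N" "z = fst e' \<or> z = snd e'"
        unfolding Field_def by fastforce
      then show ?thesis using disj[OF e, of e'] by (auto simp: N_def)
    qed
    then have uvN: "u \<notin> Field N" "v \<notin> Field N" by blast+
    have "Field N \<subseteq> Field M" by (intro mono_Field) (auto simp: N_def)
    then have xyN: "x \<notin> Field N" "y \<notin> Field N" using x(1) y(1) unfolding U_def by blast+
    have "(u, x) \<notin> insert (v, y) N" "(v, y) \<notin> N"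
      using uv uvN by (auto intro: FieldI1)
    then have "card (insert (u, x) (insert (v, y) N)) = Suc (card M)"
      using card_Suc_Diff1[OF fin e, folded N_def] finite_Diff[OF fin, of "{(u, v)}", folded N_def] by simp
    moreover have "matching G (insert (u, x) (insert (v, y) N))"
    proof (intro matching_insert)
      show "matching G N" by (rule matching_subset[OF M]) (simp add: N_def)
    qed (use x y uvN xyN uv ne nU in \<open>auto simp: Field_insert\<close>)
    ultimately show False using max[of "insert (u, x) (insert (v, y) N)"] by simp
  qed
  \<comment> \<open>If both ends have unmatched neighbours, \<open>aug\<close> says that these are
    one and the same vertex, so the first end dominates it. If neither has any, the choice is free
    and falls on the second end.\<close>
  define g where "g e = (if \<exists>x\<in>U. (fst e, x) \<in> parcs G then fst e else snd e)" for e
  define S where "S = g ` M"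
  have "dominating_set G S"
    unfolding dominating_set_def
  proof (intro conjI ballI)
    show "S \<subseteq> pverts G"
      using subsetD[OF Mp] arc_fst_in_verts arc_snd_in_verts unfolding S_def g_def
      by (intro image_subsetI) (simp split: if_split)
    fix w assume w: "w \<in> pverts G - S"
    show "\<exists>u\<in>S. (w, u) \<in> parcs G"
    proof (cases "w \<in> U")
      case True
      obtain z where z: "(w, z) \<in> parcs G" using noiso w by blast
      then have "z \<notin> U" "z \<in> pverts G" using indep True in_arcsD2 by auto
      then obtain e where e: "e \<in> M" "z = fst e \<or> z = snd e" unfolding U_def Field_def by fastforce
      have "(w, g e) \<in> parcs G"
      proof (cases "\<exists>x\<in>U. (fst e, x) \<in> parcs G")
        case xU: True
        then obtain x where x: "x \<in> U" "(fst e, x) \<in> parcs G" by blast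
        show ?thesis
        proof (cases "z = fst e")
          case False
          then have "x = w" using aug[of "fst e" "snd e" x w] e x True z arc_sym by auto
          then show ?thesis using x arc_sym xU by (auto simp: g_def)
        qed (use z xU in \<open>auto simp: g_def\<close>)
      next
        case False
        then show ?thesis using e z True arc_sym by (auto simp: g_def)
      qed
      then show ?thesis using e by (auto simp: S_def)
    next
      case False
      then obtain e where e: "e \<in> M" "w = fst e \<or> w = snd e" using w unfolding U_def Field_def by fastforce
      \<comment> \<open>A matched vertex outside \<open>S\<close> is the end of its edge that
        \<open>g\<close> did not pick, so its partner dominates it.\<close>
      then have "g e \<in> S" "g e \<noteq> w" using w by (auto simp: S_def)
      moreover have "(fst e, snd e) \<in> parcs G" using e Mp by auto
      ultimately have "(w, g e) \<in> parcs G" using e arc_sym by (auto simp: g_def split: if_splits)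
      then show ?thesis using \<open>g e \<in> S\<close> by blast
    qed
  qed
  then have "domination_number G \<le> card M"
    using domination_number_le card_image_le[OF fin, of g] unfolding S_def by fastforce
  then show ?thesis using M by blast
qed

section \<open>The quadratic form of the Laplacian and its eigenfunctions\<close>

lemma order_prod_linear_factors:
  fixes x :: "'a :: idom"
  shows "Polynomial.order x (\<Prod>a\<leftarrow>as. [:- a, 1:]) = count_list as x"
proof (induction as)
  case (Cons b as)
  have "(\<Prod>a\<leftarrow>as. [:- a, 1:]) \<noteq> 0"
    by (auto simp: prod_list_zero_iff)
  then have "[:- b, 1:] * (\<Prod>a\<leftarrow>as. [:- a, 1:]) \<noteq> 0"
    using no_zero_divisors[of "[:- b, 1:]"] by simp
  moreover have "Polynomial.order x [:- b, 1:] = (if b = x then 1 else 0)"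
    using order_power_n_n[of x 1] by (auto simp: order_0I)
  ultimately show ?case
    using Cons order_mult[of "[:- b, 1:]" "\<Prod>a\<leftarrow>as. [:- a, 1:]" x] by simp
qed simp

text \<open>Turns a count of roots with multiplicity into a count of list positions, which later
  become the indices of an eigenbasis.\<close>

lemma sum_order_linear_factors:
  fixes as :: "'a :: idom list"
  defines "p \<equiv> (\<Prod>a\<leftarrow>as. [:- a, 1:])"
  shows "(\<Sum>x | poly p x = 0 \<and> x \<in> I. Polynomial.order x p) = card {i. i < length as \<and> as ! i \<in> I}"
proof -
  have "{x. poly p x = 0 \<and> x \<in> I} = set (filter (\<lambda>x. x \<in> I) as)"
    by (auto simp: p_def poly_prod_list prod_list_zero_iff)
  then have "(\<Sum>x | poly p x = 0 \<and> x \<in> I. Polynomial.order x p)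
      = (\<Sum>x\<in>set (filter (\<lambda>x. x \<in> I) as). count_list as x)"
    by (simp add: p_def order_prod_linear_factors)
  also have "\<dots> = (\<Sum>x\<in>set (filter (\<lambda>x. x \<in> I) as). count_list (filter (\<lambda>x. x \<in> I) as) x)"
    by (intro sum.cong) (auto simp: count_list_eq_length_filter intro!: arg_cong[of _ _ length] filter_cong)
  also have "\<dots> = length (filter (\<lambda>x. x \<in> I) as)"
    by (rule sum_count_set) auto
  finally show ?thesis by (simp add: length_filter_conv_card)
qed

section \<open>The Laplacian acting on functions of the vertices\<close>

definition laplacian_op :: "'a pair_pre_digraph \<Rightarrow> ('a \<Rightarrow> real) \<Rightarrow> 'a \<Rightarrow> real" where
  "laplacian_op G x u = (\<Sum>w\<in>pverts G. if (u, w) \<in> parcs G then x u - x w else 0)"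

text \<open>Both arcs of every edge occur in \<open>parcs G\<close>, hence the division by
  2.\<close>

definition laplacian_form :: "'a pair_pre_digraph \<Rightarrow> ('a \<Rightarrow> real) \<Rightarrow> real" where
  "laplacian_form G x = (\<Sum>(u, w)\<in>parcs G. (x u - x w)\<^sup>2) / 2"

definition square_norm :: "'a pair_pre_digraph \<Rightarrow> ('a \<Rightarrow> real) \<Rightarrow> real" where
  "square_norm G x = (\<Sum>u\<in>pverts G. (x u)\<^sup>2)"

text \<open>There are as many functions as vertices, so they span all functions on the vertices and
  \<open>ev\<close> lists the spectrum with repetitions.\<close>

definition orthonormal_eigenbasis ::
    "'a pair_pre_digraph \<Rightarrow> (nat \<Rightarrow> real) \<Rightarrow> (nat \<Rightarrow> 'a \<Rightarrow> real) \<Rightarrow> bool" where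
  "orthonormal_eigenbasis G ev \<phi> \<longleftrightarrow>
     (\<forall>i < card (pverts G). \<forall>u \<in> pverts G. laplacian_op G (\<phi> i) u = ev i * \<phi> i u) \<and>
     (\<forall>i < card (pverts G). \<forall>j < card (pverts G).
        (\<Sum>u\<in>pverts G. \<phi> i u * \<phi> j u) = (if i = j then 1 else 0))"

context pair_graph
begin

lemma out_degree_eq: "u \<in> pverts G \<Longrightarrow>
    real (out_degree (with_proj G) u) = (\<Sum>w\<in>pverts G. if (u, w) \<in> parcs G then 1 else 0)"
proof -
  have "out_arcs (with_proj G) u = Pair u ` {w \<in> pverts G. (u, w) \<in> parcs G}"
    using in_arcsD2 by (auto simp: out_arcs_def)
  then have "out_degree (with_proj G) u = card {w \<in> pverts G. (u, w) \<in> parcs G}"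
    by (simp add: out_degree_def card_image inj_on_def)
  then show ?thesis using pair_finite_verts by (simp add: sum.If_cases Int_def)
qed

text \<open>Each square splits as \<open>x u * (x u - x w) + x w * (x w - x u)\<close>, and
  exchanging \<open>u\<close> and \<open>w\<close> shows that the two halves have equal sums over
  the arcs.\<close>

lemma laplacian_form_eq: "laplacian_form G x = (\<Sum>u\<in>pverts G. x u * laplacian_op G x u)"
proof -
  define d where "d u w = (if (u, w) \<in> parcs G then 1 else 0::real)" for u w
  have d: "d u w = d w u" for u w using arc_sym by (auto simp: d_def)
  have "(\<Sum>(u, w)\<in>parcs G. (x u - x w)\<^sup>2) = (\<Sum>(u, w)\<in>pverts G \<times> pverts G. d u w * (x u - x w)\<^sup>2)"
    using pair_finite_verts in_arcsD1 in_arcsD2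
    by (intro sum.mono_neutral_cong_left) (auto simp: d_def)
  also have "\<dots> = (\<Sum>u\<in>pverts G. \<Sum>w\<in>pverts G. d u w * (x u - x w)\<^sup>2)"
    by (rule sum.cartesian_product[symmetric])
  also have "\<dots> = (\<Sum>u\<in>pverts G. \<Sum>w\<in>pverts G. d u w * x u * (x u - x w) + d u w * x w * (x w - x u))"
    by (simp add: power2_eq_square algebra_simps)
  also have "\<dots> = (\<Sum>u\<in>pverts G. \<Sum>w\<in>pverts G. d u w * x u * (x u - x w))
      + (\<Sum>u\<in>pverts G. \<Sum>w\<in>pverts G. d u w * x w * (x w - x u))"
    by (simp add: sum.distrib)
  also have "(\<Sum>u\<in>pverts G. \<Sum>w\<in>pverts G. d u w * x w * (x w - x u))
      = (\<Sum>u\<in>pverts G. \<Sum>w\<in>pverts G. d u w * x u * (x u - x w))"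
    by (subst sum.swap) (simp add: d)
  also have "(\<Sum>u\<in>pverts G. \<Sum>w\<in>pverts G. d u w * x u * (x u - x w)) = (\<Sum>u\<in>pverts G. x u * laplacian_op G x u)"
    by (auto simp: laplacian_op_def sum_distrib_left d_def intro!: sum.cong)
  finally show ?thesis by (simp add: laplacian_form_def)
qed

lemma laplacian_op_sum:
  "laplacian_op G (\<lambda>u. \<Sum>j\<in>J. c j * f j u) u = (\<Sum>j\<in>J. c j * laplacian_op G (f j) u)"
proof -
  have "laplacian_op G (\<lambda>u. \<Sum>j\<in>J. c j * f j u) u
      = (\<Sum>w\<in>pverts G. \<Sum>j\<in>J. c j * (if (u, w) \<in> parcs G then f j u - f j w else 0))"
    by (auto simp: laplacian_op_def sum_subtractf right_diff_distrib intro!: sum.cong)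
  also have "\<dots> = (\<Sum>j\<in>J. \<Sum>w\<in>pverts G. c j * (if (u, w) \<in> parcs G then f j u - f j w else 0))"
    by (rule sum.swap)
  finally show ?thesis by (simp add: laplacian_op_def sum_distrib_left)
qed

lemma laplacian_form_cong:
  "(\<And>u. u \<in> pverts G \<Longrightarrow> x u = y u) \<Longrightarrow> laplacian_form G x = laplacian_form G y"
  using in_arcsD1 in_arcsD2 by (auto simp: laplacian_form_def intro!: sum.cong)

text \<open>Comparison with the complete graph, whose form is the right-hand side minus the square
  of the sum of \<open>x\<close> over the vertices.\<close>

lemma laplacian_form_le: "laplacian_form G x \<le> real (card (pverts G)) * square_norm G x"
proof -
  let ?V = "pverts G"
  have "2 * laplacian_form G x \<le> (\<Sum>(u, w)\<in>?V \<times> ?V. (x u - x w)\<^sup>2)"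
    using pair_finite_verts in_arcsD1 in_arcsD2
    by (auto simp: laplacian_form_def intro!: sum_mono2)
  also have "\<dots> = (\<Sum>u\<in>?V. \<Sum>w\<in>?V. (x u)\<^sup>2 + (x w)\<^sup>2 - 2 * (x u * x w))"
    by (simp add: sum.cartesian_product[symmetric] power2_diff mult.assoc)
  also have "\<dots> = 2 * (real (card ?V) * square_norm G x) - 2 * (\<Sum>u\<in>?V. x u)\<^sup>2"
    by (simp add: sum.distrib sum_subtractf square_norm_def power2_eq_square sum_product
        sum_distrib_left[symmetric])
  finally show ?thesis using zero_le_power2[of "\<Sum>u\<in>?V. x u"] by linarith
qed

text \<open>Carries the spectral theorem from the matrix over to functions on the vertices, so that
  the enumeration \<open>vs\<close> does not appear afterwards.\<close>

lemma orthonormal_eigenbasis_exists: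
  "\<exists>ev \<phi>. orthonormal_eigenbasis G ev \<phi> \<and>
     (\<forall>I. laplacian_eigenvalue_count G I = card {i. i < card (pverts G) \<and> ev i \<in> I})"
proof -
  define vs where "vs = vertex_enumeration G"
  define n where "n = card (pverts G)"
  have vs: "distinct vs" "set vs = pverts G"
    using vertex_enumeration[OF pair_finite_verts] by (auto simp: vs_def)
  then have len: "length vs = n" unfolding n_def by (metis distinct_card)
  have vsV: "vs ! i \<in> pverts G" if "i < n" for i using that vs len nth_mem by blast
  have sum_vs: "(\<Sum>k = 0..<n. f (vs ! k)) = (\<Sum>v\<in>pverts G. f v)" for f :: "'a \<Rightarrow> real"
    using sum.reindex_bij_betw[OF bij_betw_nth[OF vs(1) refl refl], of f] vs(2) len
    by (simp add: atLeast0LessThan)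
  define A where "A = laplacian G"
  have A: "A \<in> carrier_mat n n"
    unfolding A_def laplacian_def laplacian_matrix_def degree_matrix_def adjacency_matrix_def
      vs_def[symmetric] len by (intro minus_carrier_mat mat_carrier)
  define l where "l u v = (if u = v then real (out_degree (with_proj G) u) else 0)
      - (if (u, v) \<in> parcs G then 1 else 0)" for u v
  have Aij: "A $$ (i, j) = l (vs ! i) (vs ! j)" if "i < n" "j < n" for i j
    using that vs len
    by (simp add: A_def laplacian_def laplacian_matrix_def degree_matrix_def adjacency_matrix_def
        l_def nth_eq_iff_index_eq flip: vs_def)
  have "l u v = l v u" for u v using arc_sym by (auto simp: l_def)
  then have "transpose_mat A = A"
    using A by (intro eq_matI) (auto simp: Aij)
  then obtain P where P: "P \<in> carrier_mat n n" "transpose_mat P * P = 1\<^sub>m n"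
      "diagonal_mat (transpose_mat P * A * P)"
    using real_spectral_theorem[OF A] by blast
  define D where "D = transpose_mat P * A * P"
  have D: "D \<in> carrier_mat n n" using P A by (simp add: D_def)
  have Pt: "transpose_mat P \<in> carrier_mat n n" using P by simp
  have PPt: "P * transpose_mat P = 1\<^sub>m n"
    using mat_mult_left_right_inverse[OF Pt P(1) P(2)] .
  note assoc = assoc_mult_mat[of _ n n _ n _ n]
  \<comment> \<open>The columns of \<open>P\<close> are thus eigenvectors of \<open>A\<close>. As
    \<open>P\<close> is orthogonal, \<open>A\<close> is similar to \<open>D\<close>, and the
    diagonal of \<open>D\<close> lists the roots of the characteristic polynomial.\<close>
  have PD: "P * D = A * P"
  proof -
    have "P * D = (P * transpose_mat P) * (A * P)"
      using P(1) A Pt by (simp add: D_def assoc)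
    then show ?thesis using A P(1) by (simp add: PPt)
  qed
  have "A = A * P * transpose_mat P"
    using A P(1) Pt by (simp add: assoc PPt)
  then have "similar_mat_wit A D P (transpose_mat P)"
    using A D P Pt PPt unfolding PD[symmetric] by (auto simp: similar_mat_wit_def Let_def)
  then have "char_poly A = char_poly D"
    by (intro char_poly_similar) (auto simp: similar_mat_def)
  also have "\<dots> = (\<Prod>a\<leftarrow>diag_mat D. [:- a, 1:])"
    using D P(3) by (intro char_poly_upper_triangular) (auto simp: diagonal_mat_def D_def[symmetric])
  finally have cp: "char_poly A = (\<Prod>a\<leftarrow>diag_mat D. [:- a, 1:])" .
  define ev where "ev i = D $$ (i, i)" for i
  have dm: "length (diag_mat D) = n" "i < n \<Longrightarrow> diag_mat D ! i = ev i" for i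
    using D by (auto simp: diag_mat_def ev_def)
  have count: "laplacian_eigenvalue_count G I = card {i. i < n \<and> ev i \<in> I}" for I
  proof -
    have "laplacian_eigenvalue_count G I = card {i. i < n \<and> diag_mat D ! i \<in> I}"
      unfolding laplacian_eigenvalue_count_def A_def[symmetric] eigenvalue_root_char_poly[OF A] cp
      by (simp add: sum_order_linear_factors dm)
    also have "{i. i < n \<and> diag_mat D ! i \<in> I} = {i. i < n \<and> ev i \<in> I}"
      by (auto simp: dm)
    finally show ?thesis .
  qed
  \<comment> \<open>Column \<open>i\<close> of \<open>P\<close>, read as a function on the vertices
    by way of the position of \<open>v\<close> in \<open>vs\<close>.\<close>
  define \<phi> where "\<phi> i v = P $$ (the_inv_into {..<n} ((!) vs) v, i)" for i v
  have \<phi>: "\<phi> i (vs ! k) = P $$ (k, i)" if "k < n" for i k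
    using that vs(1) len by (simp add: \<phi>_def the_inv_into_f_f inj_on_nth)
  have orth: "(\<Sum>u\<in>pverts G. \<phi> i u * \<phi> j u) = (if i = j then 1 else 0)" if "i < n" "j < n" for i j
  proof -
    have "(\<Sum>u\<in>pverts G. \<phi> i u * \<phi> j u) = (\<Sum>k = 0..<n. P $$ (k, i) * P $$ (k, j))"
      by (simp add: \<phi> flip: sum_vs)
    also have "\<dots> = (transpose_mat P * P) $$ (i, j)"
      using that P(1) by (simp add: scalar_prod_def)
    finally show ?thesis using that P(2) by simp
  qed
  have eig: "laplacian_op G (\<phi> i) u = ev i * \<phi> i u" if i: "i < n" and u: "u \<in> pverts G" for i u
  proof -
    obtain k where k: "k < n" "u = vs ! k" using u vs len by (metis in_set_conv_nth)
    have "laplacian_op G (\<phi> i) u = (\<Sum>w\<in>pverts G. l u w * \<phi> i w)"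
    proof -
      have "(\<Sum>w\<in>pverts G. l u w * \<phi> i w)
        = (\<Sum>w\<in>pverts G. (if u = w then real (out_degree (with_proj G) u) * \<phi> i u else 0))
          - (\<Sum>w\<in>pverts G. if (u, w) \<in> parcs G then \<phi> i w else 0)"
        unfolding l_def sum_subtractf[symmetric] by (intro sum.cong) (auto simp: left_diff_distrib)
      also have "\<dots> = (\<Sum>w\<in>pverts G. if (u, w) \<in> parcs G then \<phi> i u else 0)
          - (\<Sum>w\<in>pverts G. if (u, w) \<in> parcs G then \<phi> i w else 0)"
        using u pair_finite_verts by (auto simp: out_degree_eq sum_distrib_right intro!: sum.cong)
      also have "\<dots> = laplacian_op G (\<phi> i) u"
        unfolding laplacian_op_def sum_subtractf[symmetric] by (intro sum.cong) auto
      finally show ?thesis ..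
    qed
    also have "\<dots> = (\<Sum>j = 0..<n. A $$ (k, j) * P $$ (j, i))"
      using k by (simp add: Aij \<phi> flip: sum_vs)
    also have "\<dots> = (A * P) $$ (k, i)"
      using k i A P(1) by (simp add: scalar_prod_def)
    also have "\<dots> = (\<Sum>j = 0..<n. P $$ (k, j) * D $$ (j, i))"
      using k i D P(1) by (simp add: scalar_prod_def flip: PD)
    also have "\<dots> = (\<Sum>j = 0..<n. if j = i then P $$ (k, i) * D $$ (i, i) else 0)"
      using D P(3) i by (intro sum.cong) (auto simp: diagonal_mat_def D_def[symmetric])
    also have "\<dots> = ev i * \<phi> i u" using k i by (simp add: \<phi> ev_def)
    finally show ?thesis .
  qed
  show ?thesis
    using count orth eig unfolding orthonormal_eigenbasis_def n_def by blast
qed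

text \<open>Parseval on the span of part of the eigenbasis. In the two main estimates
  \<open>J\<close> holds the indices of the eigenvalues on one side of 2.\<close>

lemma eigenbasis_inner:
  assumes basis: "orthonormal_eigenbasis G ev \<phi>"
    and J: "J \<subseteq> {..<card (pverts G)}"
  shows "(\<Sum>u\<in>pverts G. (\<Sum>i\<in>J. a i * \<phi> i u) * (\<Sum>j\<in>J. b j * \<phi> j u)) = (\<Sum>i\<in>J. a i * b i)"
proof -
  have fin: "finite J" using J finite_subset by blast
  have "(\<Sum>u\<in>pverts G. (\<Sum>i\<in>J. a i * \<phi> i u) * (\<Sum>j\<in>J. b j * \<phi> j u))
      = (\<Sum>u\<in>pverts G. \<Sum>i\<in>J. \<Sum>j\<in>J. a i * b j * (\<phi> i u * \<phi> j u))"
    by (simp add: sum_product mult_ac)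
  also have "\<dots> = (\<Sum>i\<in>J. \<Sum>j\<in>J. \<Sum>u\<in>pverts G. a i * b j * (\<phi> i u * \<phi> j u))"
    by (subst sum.swap, rule sum.cong[OF refl], rule sum.swap)
  also have "\<dots> = (\<Sum>i\<in>J. \<Sum>j\<in>J. if i = j then a i * b j else 0)"
    using basis J
    by (intro sum.cong refl) (auto simp: orthonormal_eigenbasis_def subset_iff simp flip: sum_distrib_left)
  finally show ?thesis using fin by simp
qed

context
  fixes ev \<phi> J c x
  assumes basis: "orthonormal_eigenbasis G ev \<phi>"
    and J: "J \<subseteq> {..<card (pverts G)}"
    and x: "\<And>u. u \<in> pverts G \<Longrightarrow> x u = (\<Sum>j\<in>J. c j * \<phi> j u)"
begin

lemma square_norm_eigenbasis: "square_norm G x = (\<Sum>j\<in>J. (c j)\<^sup>2)"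
  using eigenbasis_inner[OF basis J, of c c] by (simp add: square_norm_def x power2_eq_square)

lemma laplacian_form_eigenbasis: "laplacian_form G x = (\<Sum>j\<in>J. ev j * (c j)\<^sup>2)"
proof -
  have op: "laplacian_op G (\<phi> j) u = ev j * \<phi> j u" if "j \<in> J" "u \<in> pverts G" for j u
    using basis J that by (auto simp: orthonormal_eigenbasis_def)
  have "laplacian_form G x = laplacian_form G (\<lambda>u. \<Sum>j\<in>J. c j * \<phi> j u)"
    by (rule laplacian_form_cong) (rule x)
  also have "\<dots> = (\<Sum>u\<in>pverts G. (\<Sum>j\<in>J. c j * \<phi> j u) * (\<Sum>j\<in>J. c j * ev j * \<phi> j u))"
    unfolding laplacian_form_eq laplacian_op_sum
    by (simp add: op mult.assoc cong: sum.cong)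
  also have "\<dots> = (\<Sum>j\<in>J. c j * (c j * ev j))"
    by (rule eigenbasis_inner[OF basis J])
  finally show ?thesis by (simp add: power2_eq_square mult_ac)
qed

end

text \<open>At \<open>\<phi> i\<close> the square norm is 1 and the form is \<open>ev i\<close>.
  This makes the upper end of the interval \<open>{2..real n}\<close> no restriction.\<close>

lemma eigenvalue_le_card:
  assumes "orthonormal_eigenbasis G ev \<phi>" "i < card (pverts G)"
  shows "ev i \<le> real (card (pverts G))"
  using laplacian_form_le[of "\<phi> i"] laplacian_form_eigenbasis[OF assms(1), of "{i}" "\<phi> i" "\<lambda>_. 1"]
    square_norm_eigenbasis[OF assms(1), of "{i}" "\<phi> i" "\<lambda>_. 1"] assms(2)
  by simp

section \<open>Counting the eigenvalues that are at least two\<close>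

text \<open>A vector with coefficient \<open>a (Inl e)\<close> at each matching edge has square norm
  at most twice the sum of the \<open>(a (Inl e))\<^sup>2\<close>, while its form is at least four
  times that sum. In the span of the eigenfunctions for eigenvalues below 2 only zero satisfies
  this.\<close>

lemma matching_le_eigenvalue_count:
  assumes basis: "orthonormal_eigenbasis G ev \<phi>" and M: "matching G M"
  shows "card M \<le> card {i. i < card (pverts G) \<and> ev i \<ge> 2}"
proof (rule ccontr)
  let ?n = "card (pverts G)"
  assume "\<not> ?thesis"
  then have less: "card {i. i < ?n \<and> ev i \<ge> 2} < card M" by simp
  have Mp: "M \<subseteq> parcs G"
    and disj: "\<And>e e'. e \<in> M \<Longrightarrow> e' \<in> M \<Longrightarrow> e \<noteq> e' \<Longrightarrow> {fst e, snd e} \<inter> {fst e', snd e'} = {}"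
    using M by (auto simp: matching_def)
  have fin: "finite M" using Mp pair_finite_arcs finite_subset by blast
  define J where "J = {i. i < ?n \<and> ev i < 2}"
  have "J \<union> {i. i < ?n \<and> ev i \<ge> 2} = {..<?n}" "J \<inter> {i. i < ?n \<and> ev i \<ge> 2} = {}" "finite J"
    by (auto simp: J_def)
  then have "card J + card {i. i < ?n \<and> ev i \<ge> 2} = ?n"
    by (metis (no_types, lifting) card_Un_disjoint card_lessThan finite_Un finite_lessThan)
  \<comment> \<open>The span of the matching vectors and the span of the eigenfunctions for eigenvalues below 2
      have dimensions that add up to more than \<open>n\<close>, so they meet.\<close>
  then have "?n < card (M <+> J)"
    using less fin \<open>finite J\<close> by (simp add: card_Plus)
  define h where "h e u = (if u = fst e then 1 else if u = snd e then -1 else 0::real)" for e and u :: 'a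
  \<comment> \<open>One equation per vertex and one unknown per vector. The minus sign makes a
    solution say that the combination of matching vectors and that of eigenfunctions agree at every
    vertex.\<close>
  obtain a where a: "\<exists>j\<in>M <+> J. a j \<noteq> 0"
      "\<forall>u\<in>pverts G. (\<Sum>j\<in>M <+> J. a j * (case j of Inl e \<Rightarrow> h e u | Inr i \<Rightarrow> - \<phi> i u)) = 0"
    using underdetermined_system[OF pair_finite_verts _ \<open>?n < card (M <+> J)\<close>,
        of "\<lambda>u j. case j of Inl e \<Rightarrow> h e u | Inr i \<Rightarrow> - \<phi> i u"]
      fin \<open>finite J\<close> by auto
  define x where "x u = (\<Sum>e\<in>M. a (Inl e) * h e u)" for u
  have x: "x u = (\<Sum>i\<in>J. a (Inr i) * \<phi> i u)" if "u \<in> pverts G" for u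
  proof -
    have "0 = x u - (\<Sum>i\<in>J. a (Inr i) * \<phi> i u)"
      using a(2)[rule_format, OF that] fin \<open>finite J\<close> by (simp add: sum.Plus x_def sum_negf)
    then show ?thesis by simp
  qed
  have neq: "fst e \<noteq> snd e" if "e \<in> M" for e using that Mp pair_no_loops by blast
  have h: "h e' (fst e) = (if e' = e then 1 else 0)" "h e' (snd e) = (if e' = e then -1 else 0)"
    if "e \<in> M" "e' \<in> M" for e e'
  proof -
    have "h e' (fst e) = (if e' = e then 1 else 0) \<and> h e' (snd e) = (if e' = e then -1 else 0)"
    proof (cases "e' = e")
      case True
      then show ?thesis using neq[OF that(1)] by (simp add: h_def)
    next
      case False
      then have "{fst e', snd e'} \<inter> {fst e, snd e} = {}" using disj[OF that(2,1)] by blast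
      then show ?thesis using False by (simp add: h_def)
    qed
    then show "h e' (fst e) = (if e' = e then 1 else 0)" "h e' (snd e) = (if e' = e then -1 else 0)"
      by blast+
  qed
  have xe: "x (fst e) = a (Inl e)" "x (snd e) = - a (Inl e)" if "e \<in> M" for e
    using that fin by (simp_all add: x_def h if_distrib[of "\<lambda>t. _ * t"] cong: if_cong)
  have x0: "x u = 0" if "u \<notin> fst ` M \<union> snd ` M" for u
  proof -
    have "h e u = 0" if "e \<in> M" for e
      using \<open>u \<notin> _\<close> imageI[OF that, of fst] imageI[OF that, of snd] unfolding h_def by auto
    then show ?thesis by (simp add: x_def)
  qed
  have "fst ` M \<union> snd ` M \<subseteq> pverts G"
    using subsetD[OF Mp] arc_fst_in_verts arc_snd_in_verts by (intro Un_least image_subsetI) simp_all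
  then have "square_norm G x = (\<Sum>u\<in>fst ` M \<union> snd ` M. (x u)\<^sup>2)"
    unfolding square_norm_def by (rule sum.mono_neutral_right[OF pair_finite_verts]) (simp add: x0)
  also have "\<dots> \<le> (\<Sum>u\<in>fst ` M. (x u)\<^sup>2) + (\<Sum>u\<in>snd ` M. (x u)\<^sup>2)"
    using fin by (simp add: sum_Un sum_nonneg)
  also have "\<dots> \<le> (\<Sum>e\<in>M. (x (fst e))\<^sup>2) + (\<Sum>e\<in>M. (x (snd e))\<^sup>2)"
    using sum_image_le[of M "\<lambda>u. (x u)\<^sup>2" fst] sum_image_le[of M "\<lambda>u. (x u)\<^sup>2" snd] fin
    by (simp add: o_def)
  also have "\<dots> = 2 * (\<Sum>e\<in>M. (a (Inl e))\<^sup>2)" by (simp add: xe)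
  finally have nrm: "square_norm G x \<le> 2 * (\<Sum>e\<in>M. (a (Inl e))\<^sup>2)" .
  \<comment> \<open>The form sums over both arcs of an edge, so the reversed arcs of the matching
    are counted as well; this needs them to be different from the arcs in \<open>M\<close>.\<close>
  have MM: "M \<inter> prod.swap ` M = {}"
  proof (rule ccontr)
    assume "M \<inter> prod.swap ` M \<noteq> {}"
    then obtain e where e: "e \<in> M" "prod.swap e \<in> M" by auto
    moreover have "prod.swap e \<noteq> e" using neq[OF e(1)] by (cases e) auto
    ultimately show False using disj[of e "prod.swap e"] by auto
  qed
  have "(\<Sum>e\<in>M. (x (fst e) - x (snd e))\<^sup>2) + (\<Sum>e\<in>prod.swap ` M. (x (fst e) - x (snd e))\<^sup>2)
      = (\<Sum>e\<in>M \<union> prod.swap ` M. (x (fst e) - x (snd e))\<^sup>2)"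
    using fin MM by (intro sum.union_disjoint[symmetric]) auto
  also have "\<dots> \<le> (\<Sum>e\<in>parcs G. (x (fst e) - x (snd e))\<^sup>2)"
    using pair_finite_arcs Mp arc_sym by (intro sum_mono2) auto
  also have "\<dots> = 2 * laplacian_form G x" by (simp add: laplacian_form_def case_prod_beta)
  also have "(\<Sum>e\<in>prod.swap ` M. (x (fst e) - x (snd e))\<^sup>2) = (\<Sum>e\<in>M. (x (fst e) - x (snd e))\<^sup>2)"
    by (subst sum.reindex) (auto simp: power2_commute)
  also have "(\<Sum>e\<in>M. (x (fst e) - x (snd e))\<^sup>2) = 4 * (\<Sum>e\<in>M. (a (Inl e))\<^sup>2)"
    by (simp add: xe sum_distrib_left power2_eq_square algebra_simps)
  finally have "2 * square_norm G x \<le> laplacian_form G x" using nrm by simp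
  moreover have JV: "J \<subseteq> {..<?n}" by (auto simp: J_def)
  ultimately have le: "(\<Sum>j\<in>J. 2 * (a (Inr j))\<^sup>2) \<le> (\<Sum>j\<in>J. ev j * (a (Inr j))\<^sup>2)"
    using square_norm_eigenbasis[OF basis JV x] laplacian_form_eigenbasis[OF basis JV x]
    by (simp add: sum_distrib_left)
  \<comment> \<open>A nonzero coefficient here would push the form strictly below twice the square
    norm. With all of them zero, \<open>x\<close> vanishes on the vertices, and its values at the
    matched ends show that the coefficients on \<open>M\<close> vanish too.\<close>
  have aJ: "a (Inr j) = 0" if "j \<in> J" for j
  proof (rule ccontr)
    assume "a (Inr j) \<noteq> 0"
    then have "(\<Sum>j\<in>J. ev j * (a (Inr j))\<^sup>2) < (\<Sum>j\<in>J. 2 * (a (Inr j))\<^sup>2)"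
      using that \<open>finite J\<close>
      by (intro sum_strict_mono_ex1) (auto simp: J_def intro!: mult_right_mono bexI[of _ j])
    then show False using le by simp
  qed
  then have "x u = 0" if "u \<in> pverts G" for u using x[OF that] by simp
  then have "a (Inl e) = 0" if "e \<in> M" for e
    using xe(1)[OF that] that Mp arc_fst_in_verts by auto
  then show False using a(1) aJ by auto
qed

text \<open>Vanishing on \<open>S\<close> gives \<open>card S\<close> conditions, and the edges
  other than the \<open>n - card S\<close> chosen ones give one each, in total
  \<open>card (edges G) + 2 * card S - n\<close>, where \<open>n\<close> is the number of vertices.
  With more eigenvalues of at least 2 than that, some nonzero \<open>x\<close> in the span of their
  eigenfunctions meets all conditions; its form is then at most its square norm but also at least
  twice that.\<close>

lemma eigenvalue_count_le_domination:
  assumes basis: "orthonormal_eigenbasis G ev \<phi>" and S: "dominating_set G S"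
  shows "card {i. i < card (pverts G) \<and> ev i \<ge> 2} + card (pverts G) \<le> card (edges G) + 2 * card S"
proof (rule ccontr)
  let ?V = "pverts G" and ?n = "card (pverts G)"
  define J where "J = {i. i < ?n \<and> ev i \<ge> 2}"
  assume "\<not> ?thesis"
  then have less: "card (edges G) + 2 * card S < card J + ?n" by (simp add: J_def)
  have SV: "S \<subseteq> ?V" and "\<forall>v\<in>?V - S. \<exists>u\<in>S. (v, u) \<in> parcs G"
    using S by (auto simp: dominating_set_def)
  then obtain f where f: "\<And>v. v \<in> ?V - S \<Longrightarrow> f v \<in> S \<and> (v, f v) \<in> parcs G" by metis
  have finS: "finite S" using SV pair_finite_verts finite_subset by blast
  define E0 where "E0 = (\<lambda>v. {v, f v}) ` (?V - S)"
  have "edges G = (\<lambda>(u, v). {u, v}) ` parcs G" by (auto simp: edges_def)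
  then have finE: "finite (edges G)" using pair_finite_arcs by simp
  have E0: "E0 \<subseteq> edges G" using f by (auto simp: E0_def edges_def)
  \<comment> \<open>An edge from \<open>v\<close> outside \<open>S\<close> to \<open>f v\<close>
    inside \<open>S\<close> determines \<open>v\<close>, so no two vertices choose the same
    edge.\<close>
  have "inj_on (\<lambda>v. {v, f v}) (?V - S)"
    using f by (auto simp: inj_on_def doubleton_eq_iff)
  then have "card E0 = ?n - card S"
    using SV finS by (simp add: E0_def card_image card_Diff_subset)
  moreover have "card S \<le> ?n" using SV pair_finite_verts by (rule card_mono[rotated])
  moreover have "card (edges G - E0) = card (edges G) - card E0" "card E0 \<le> card (edges G)"
    using card_Diff_subset[OF finite_subset[OF E0 finE] E0] card_mono[OF finE E0] by auto
  ultimately have small: "card (S <+> (edges G - E0)) < card J"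
    using less finS finE by (simp add: card_Plus)
  \<comment> \<open>\<open>p\<close> orients the edges outside \<open>E0\<close>.\<close>
  have "\<forall>e\<in>edges G - E0. \<exists>p. e = {fst p, snd p}" by (auto simp: edges_def)
  then obtain p where p: "\<And>e. e \<in> edges G - E0 \<Longrightarrow> e = {fst (p e), snd (p e)}" by metis
  have finJ: "finite J" by (simp add: J_def)
  \<comment> \<open>The unknowns are the coordinates of \<open>x\<close> in the eigenbasis;
    \<open>Inl\<close> gives the condition at a vertex of \<open>S\<close>, \<open>Inr\<close> that
    at a remaining edge.\<close>
  obtain c where c: "\<exists>j\<in>J. c j \<noteq> 0"
      "\<forall>k\<in>S <+> (edges G - E0). (\<Sum>j\<in>J. c j * (case k of Inl s \<Rightarrow> \<phi> j s
         | Inr e \<Rightarrow> \<phi> j (fst (p e)) - \<phi> j (snd (p e)))) = 0"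
    using underdetermined_system[OF _ finJ small, of "\<lambda>k j. case k of Inl s \<Rightarrow> \<phi> j s
         | Inr e \<Rightarrow> \<phi> j (fst (p e)) - \<phi> j (snd (p e))"] finS finE by auto
  define x where "x u = (\<Sum>j\<in>J. c j * \<phi> j u)" for u
  have xS: "x s = 0" if "s \<in> S" for s
    using c(2)[rule_format, of "Inl s"] that by (simp add: x_def InlI)
  have xp: "x (fst (p e)) = x (snd (p e))" if "e \<in> edges G - E0" for e
    using c(2)[rule_format, of "Inr e"] that by (simp add: x_def InrI right_diff_distrib sum_subtractf)
  have xE: "x u = x w" if "(u, w) \<in> parcs G" "{u, w} \<notin> E0" for u w
  proof -
    have mem: "{u, w} \<in> edges G - E0" using that by (auto simp: edges_def)
    from p[OF mem] have "u = fst (p {u, w}) \<and> w = snd (p {u, w}) \<or> u = snd (p {u, w}) \<and> w = fst (p {u, w})"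
      by (simp only: doubleton_eq_iff)
    then show ?thesis using xp[OF mem] by metis
  qed
  \<comment> \<open>The two orientations of the edges in \<open>E0\<close>; by \<open>xE\<close> all
    other arcs contribute nothing to the form. Since \<open>x\<close> vanishes at
    \<open>f v\<close>, each arc here contributes \<open>(x v)\<^sup>2\<close>.\<close>
  define A1 where "A1 = (\<lambda>v. (v, f v)) ` (?V - S)"
  define A2 where "A2 = (\<lambda>v. (f v, v)) ` (?V - S)"
  have fin: "finite A1" "finite A2" using pair_finite_verts by (auto simp: A1_def A2_def)
  have "2 * laplacian_form G x = (\<Sum>e\<in>parcs G. (x (fst e) - x (snd e))\<^sup>2)"
    by (simp add: laplacian_form_def case_prod_beta)
  also have "\<dots> = (\<Sum>e\<in>A1 \<union> A2. (x (fst e) - x (snd e))\<^sup>2)"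
  proof (rule sum.mono_neutral_right)
    show "A1 \<union> A2 \<subseteq> parcs G" using f arc_sym by (auto simp: A1_def A2_def)
    show "\<forall>e\<in>parcs G - (A1 \<union> A2). (x (fst e) - x (snd e))\<^sup>2 = 0"
    proof
      fix e assume e: "e \<in> parcs G - (A1 \<union> A2)"
      have "{fst e, snd e} \<notin> E0"
      proof
        assume "{fst e, snd e} \<in> E0"
        then obtain v where "v \<in> ?V - S" "{fst e, snd e} = {v, f v}" by (auto simp: E0_def)
        moreover from this have "e = (v, f v) \<or> e = (f v, v)"
          by (cases e) (auto simp: doubleton_eq_iff)
        ultimately show False using e by (auto simp: A1_def A2_def)
      qed
      then show "(x (fst e) - x (snd e))\<^sup>2 = 0" using xE[of "fst e" "snd e"] e by simp
    qed
  qed (rule pair_finite_arcs)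
  also have "\<dots> \<le> (\<Sum>e\<in>A1. (x (fst e) - x (snd e))\<^sup>2) + (\<Sum>e\<in>A2. (x (fst e) - x (snd e))\<^sup>2)"
    using fin by (simp add: sum_Un sum_nonneg)
  also have "(\<Sum>e\<in>A1. (x (fst e) - x (snd e))\<^sup>2) = (\<Sum>v\<in>?V - S. (x v)\<^sup>2)"
    unfolding A1_def by (subst sum.reindex) (auto simp: inj_on_def xS f)
  also have "(\<Sum>e\<in>A2. (x (fst e) - x (snd e))\<^sup>2) = (\<Sum>v\<in>?V - S. (x v)\<^sup>2)"
    unfolding A2_def by (subst sum.reindex) (auto simp: inj_on_def xS f)
  also have "(\<Sum>v\<in>?V - S. (x v)\<^sup>2) \<le> square_norm G x"
    unfolding square_norm_def using pair_finite_verts by (intro sum_mono2) auto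
  finally have "laplacian_form G x \<le> square_norm G x" by simp
  moreover have JV: "J \<subseteq> {..<?n}" by (auto simp: J_def)
  ultimately have "(\<Sum>j\<in>J. ev j * (c j)\<^sup>2) \<le> (\<Sum>j\<in>J. (c j)\<^sup>2)"
    using square_norm_eigenbasis[OF basis JV, of x c] laplacian_form_eigenbasis[OF basis JV, of x c]
    by (simp add: x_def)
  moreover obtain j where "j \<in> J" "c j \<noteq> 0" using c(1) by blast
  then have "(\<Sum>j\<in>J. (c j)\<^sup>2) < (\<Sum>j\<in>J. ev j * (c j)\<^sup>2)"
    using finJ by (intro sum_strict_mono_ex1) (auto simp: J_def mult_le_cancel_right1 intro!: bexI[of _ j])
  ultimately show False by simp
qed

text \<open>The first arc of a path to some other vertex provides the neighbour.\<close>

lemma connected_no_isolated: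
  assumes "Digraph_Component.connected (with_proj G)" "v \<in> pverts G" "card (pverts G) > 1"
  shows "\<exists>u. (v, u) \<in> parcs G"
proof -
  have "pverts G \<noteq> {v}" using assms(3) by auto
  then obtain w where w: "w \<in> pverts G" "w \<noteq> v" using assms(2) by blast
  have "v \<rightarrow>\<^sup>*\<^bsub>mk_symmetric (with_proj G)\<^esub> w"
    using assms(1,2) w(1) by (simp add: Digraph_Component.connected_def strongly_connected_def)
  then have "v \<rightarrow>\<^sup>*\<^bsub>with_proj G\<^esub> w"
    using reachable_mk_symmetric_eq[OF pair_sym_arcs] by blast
  then have "(v, w) \<in> (parcs G)\<^sup>*"
    using rtrancl_on_rtranclI by (auto simp: reachable_def)
  then show ?thesis using w(2) by (metis converse_rtranclE)
qed

end

section \<open>The two bounds for c-cyclic graphs\<close>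

theorem theorem11:
  fixes G :: "'a pair_pre_digraph" and c n :: nat
  assumes "c \<ge> 1"
    and "c_cyclic c G"
    and "card (pverts G) = n"
  shows "1 \<le> real (laplacian_eigenvalue_count G {2..real n}) / real (domination_number G)
    \<and> real (laplacian_eigenvalue_count G {2..real n}) / real (domination_number G) \<le> real c + 1"
proof -
  interpret pair_graph G using assms(2) by (simp add: c_cyclic_def)
  have conn: "Digraph_Component.connected (with_proj G)" and edges: "card (edges G) = n - 1 + c"
    using assms(2,3) by (simp_all add: c_cyclic_def)
  have ne: "pverts G \<noteq> {}"
    using conn by (auto simp: Digraph_Component.connected_def strongly_connected_def)
  then have "card (pverts G) > 0" using pair_finite_verts by (simp add: card_gt_0_iff)
  then have "n \<ge> 1" using assms(3) by simp
  \<comment> \<open>A single vertex has no edges, whereas \<open>c \<ge> 1\<close> demands at least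
    one. This excludes the connected graph with an isolated vertex, which has no matching of the
    required size.\<close>
  have "n \<noteq> 1"
  proof
    assume "n = 1"
    then obtain v where "pverts G = {v}" using assms(3) card_1_singletonE by metis
    then have "parcs G = {}" using in_arcsD1 in_arcsD2 arc_neq by fastforce
    then show False using edges assms(1) by (simp add: edges_def)
  qed
  obtain ev \<phi> where basis: "orthonormal_eigenbasis G ev \<phi>"
    and "\<And>I. laplacian_eigenvalue_count G I = card {i. i < card (pverts G) \<and> ev i \<in> I}"
    using orthonormal_eigenbasis_exists by blast
  then have count: "laplacian_eigenvalue_count G {2..real n} = card {i. i < card (pverts G) \<and> ev i \<ge> 2}"
    using eigenvalue_le_card[OF basis] assms(3) by (auto intro!: arg_cong[of _ _ card])
  obtain S where S: "dominating_set G S" "card S = domination_number G"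
    using minimum_dominating_set by blast
  have "S \<noteq> {}" "finite S"
    using S(1) ne finite_subset[OF _ pair_finite_verts, of S] by (auto simp: dominating_set_def)
  then have pos: "domination_number G \<ge> 1" using S(2) by (simp add: Suc_leI card_gt_0_iff flip: S(2))
  obtain M where M: "matching G M" "domination_number G \<le> card M"
    using domination_number_le_matching[OF connected_no_isolated[OF conn]] \<open>n \<ge> 1\<close> \<open>n \<noteq> 1\<close> assms(3)
    by auto
  have lower: "domination_number G \<le> laplacian_eigenvalue_count G {2..real n}"
    using matching_le_eigenvalue_count[OF basis M(1)] M(2) count by simp
  have "laplacian_eigenvalue_count G {2..real n} + n \<le> n - 1 + c + 2 * domination_number G"
    using eigenvalue_count_le_domination[OF basis S(1)] count S(2) edges assms(3) by simp
  then have "laplacian_eigenvalue_count G {2..real n} + 1 \<le> c + 2 * domination_number G"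
    using \<open>n \<ge> 1\<close> by simp
  \<comment> \<open>The target \<open>(c + 1) * domination_number G\<close> exceeds
    \<open>c + 2 * domination_number G - 1\<close> by exactly
    \<open>(c - 1) * (domination_number G - 1)\<close>, which is \<open>b * d\<close>.\<close>
  moreover obtain b d where "c = Suc b" "domination_number G = Suc d"
    using assms(1) pos by (metis Suc_le_D One_nat_def)
  ultimately have "laplacian_eigenvalue_count G {2..real n} \<le> (c + 1) * domination_number G"
    by simp
  then have "real (laplacian_eigenvalue_count G {2..real n}) \<le> real ((c + 1) * domination_number G)"
    by (rule of_nat_mono)
  also have "\<dots> = (real c + 1) * real (domination_number G)"
    by (simp only: of_nat_mult of_nat_add of_nat_1)
  finally have upper: "real (laplacian_eigenvalue_count G {2..real n})
      \<le> (real c + 1) * real (domination_number G)" .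
  then show ?thesis
    using lower upper pos by (simp add: divide_le_eq le_divide_eq)
qed

end
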